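(* Let $D$ be an oriented graph missing $3$ disjoint stars whose centers form a directed triangle in $D$. If the dependency digraph $\Delta$ of $D$ has no isolated vertices, then $D$ satisfies the second neighborhood conjecture, that is, there is a vertex $v\in V(D)$ with $d^+_D(v)\le d^{++}_D(v)$.
   Context: All digraphs are finite. An oriented graph is a digraph without loops and without digons (directed cycles of length two). Write $x\rightarrow y$ if $(x,y)$ is an arc. $N^+(v)$ is the set of out-neighbors of $v$ and $N^{++}(v)$ is the set of vertices at distance exactly $2$ from $v$ (reached from $v$ by a directed path of length 2 but not by one of length 0 or 1); $d^+(v)=|N^+(v)|$, $d^{++}(v)=|N^{++}(v)|$. For distinct vertices $x,y$ of $D$, $xy$ is a missing edge if neither $(x,y)$ nor $(y,x)$ is an arc of $D$. The missing graph of $D$ is the graph whose edges are the missing edges of $D$ and whose vertices are the vertices of $D$ that are not adjacent to all other vertices. A star of center $x$ is a graph whose edge set has the form $\{a_ix : i=1,\dots,k\}$ with $k\ge 1$, the $a_i$ distinct and different from $x$ (when $k=1$, one of the two endpoints is designated as center). $D$ is missing 3 disjoint stars if its missing graph is the union of three pairwise vertex-disjoint stars. The centers $x,y,z$ of the stars form a directed triangle if the subdigraph of $D$ induced by $\{x,y,z\}$ is a directed cycle of length $3$. Dependency digraph: for missing edges $e$ and $e'$ of $D$, $e$ loses to $e'$ if the endpoints can be named $e=x_1y_1$, $e'=x_2y_2$ so that $x_1\rightarrow x_2$, $y_2\notin N^+(x_1)\cup N^{++}(x_1)$, $y_1\rightarrow y_2$ and $x_2\notin N^+(y_1)\cup N^{++}(y_1)$.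 The dependency digraph $\Delta$ of $D$ has the missing edges of $D$ as vertices, and an arc $(e,e')$ whenever $e$ loses to $e'$ (digons in $\Delta$ are allowed). A vertex of $\Delta$ is isolated if it has in-degree $0$ and out-degree $0$ in $\Delta$. *)

theory Defs
  imports "Graph_Theory.Graph_Theory"
begin

text \<open>Since \<^locale>\<open>pair_digraph\<close> already supplies finiteness and looplessness, only
  digons have to be excluded.\<close>

locale oriented_graph = pair_digraph +
  assumes no_digons: "(u, v) \<in> parcs G \<Longrightarrow> (v, u) \<notin> parcs G"

definition out_nbrs :: "'a pair_pre_digraph \<Rightarrow> 'a \<Rightarrow> 'a set" where
  "out_nbrs D v = {w \<in> pverts D. (v, w) \<in> parcs D}"

definition second_out_nbrs :: "'a pair_pre_digraph \<Rightarrow> 'a \<Rightarrow> 'a set" where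
  "second_out_nbrs D v =
     {w \<in> pverts D. w \<noteq> v \<and> (v, w) \<notin> parcs D \<and> (\<exists>u. (v, u) \<in> parcs D \<and> (u, w) \<in> parcs D)}"

definition satisfies_SNC :: "'a pair_pre_digraph \<Rightarrow> bool" where
  "satisfies_SNC D \<longleftrightarrow> (\<exists>v\<in>pverts D. card (out_nbrs D v) \<le> card (second_out_nbrs D v))"


text \<open>An undirected simple graph is a pair of a vertex set and a set of two-element edges.\<close>

type_synonym 'a ugraph = "'a set \<times> 'a set set"

definition non_adjacent :: "'a pair_pre_digraph \<Rightarrow> 'a \<Rightarrow> 'a \<Rightarrow> bool" where
  "non_adjacent D x y \<longleftrightarrow> x \<in> pverts D \<and> y \<in> pverts D \<and> x \<noteq> y \<and>
     (x, y) \<notin> parcs D \<and> (y, x) \<notin> parcs D"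

definition missing_edges :: "'a pair_pre_digraph \<Rightarrow> 'a set set" where
  "missing_edges D = {{x, y} | x y. non_adjacent D x y}"

definition missing_graph :: "'a pair_pre_digraph \<Rightarrow> 'a ugraph" where
  "missing_graph D = ({x \<in> pverts D. \<exists>y. non_adjacent D x y}, missing_edges D)"

definition star :: "'a \<Rightarrow> 'a ugraph \<Rightarrow> bool" where
  "star x S \<longleftrightarrow> (\<exists>A. finite A \<and> A \<noteq> {} \<and> x \<notin> A \<and> S = (insert x A, {{a, x} | a. a \<in> A}))"

definition missing_3_disjoint_stars :: "'a pair_pre_digraph \<Rightarrow> 'a \<Rightarrow> 'a \<Rightarrow> 'a \<Rightarrow> bool" where
  "missing_3_disjoint_stars D x y z \<longleftrightarrow>
     (\<exists>S T U. star x S \<and> star y T \<and> star z U \<and>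
        fst S \<inter> fst T = {} \<and> fst S \<inter> fst U = {} \<and> fst T \<inter> fst U = {} \<and>
        missing_graph D = (fst S \<union> fst T \<union> fst U, snd S \<union> snd T \<union> snd U))"

definition directed_3_cycle :: "('a, 'b) pre_digraph \<Rightarrow> bool" where
  "directed_3_cycle H \<longleftrightarrow>
     (\<exists>a b c. a \<noteq> b \<and> b \<noteq> c \<and> c \<noteq> a \<and>
        verts H = {a, b, c} \<and> arcs_ends H = {(a, b), (b, c), (c, a)})"


definition loses_to :: "'a pair_pre_digraph \<Rightarrow> 'a set \<Rightarrow> 'a set \<Rightarrow> bool" where
  "loses_to D e e' \<longleftrightarrow>
     (\<exists>x1 y1 x2 y2. e = {x1, y1} \<and> e' = {x2, y2} \<and>
        (x1, x2) \<in> parcs D \<and> y2 \<notin> out_nbrs D x1 \<union> second_out_nbrs D x1 \<and>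
        (y1, y2) \<in> parcs D \<and> x2 \<notin> out_nbrs D y1 \<union> second_out_nbrs D y1)"

definition dependency_digraph :: "'a pair_pre_digraph \<Rightarrow> 'a set pair_pre_digraph" where
  "dependency_digraph D =
     \<lparr> pverts = missing_edges D,
       parcs = {(e, e'). e \<in> missing_edges D \<and> e' \<in> missing_edges D \<and> loses_to D e e'} \<rparr>"

definition isolated_vertex :: "('a, 'b) pre_digraph \<Rightarrow> 'a \<Rightarrow> bool" where
  "isolated_vertex H v \<longleftrightarrow> v \<in> verts H \<and> in_degree H v = 0 \<and> out_degree H v = 0"

end

theory Submission
  imports Defs
begin

text \<open>Complete \<open>D\<close> to a tournament: a missing edge \<open>{s, l}\<close> with center \<open>s\<close> is directed to \<open>l\<close> if
  this creates no new second out-neighbours, and to \<open>s\<close> otherwise. Then the last vertex \<open>f\<close> of a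
  median order, with the missing edges at \<open>f\<close> redirected to \<open>f\<close>, has at most one second
  out-neighbour in the tournament that it does not have in \<open>D\<close>, and that one is a center. To absorb this
  error of one, the median order is taken with weight 3 on the centers and 4 elsewhere: a false
  second out-neighbour then contributes less than a full vertex, and because the centers form a
  directed triangle the lighter weight of the centers that are out-neighbours of \<open>f\<close> does not
  matter.\<close>

section \<open>Weighted median orders\<close>

text \<open>An arc counts with the product of its end weights, so every arc at \<open>v\<close>
  carries the factor \<open>\<omega> v\<close>, which cancels when only arcs at \<open>v\<close> are
  compared.\<close>

definition cross_weight :: "('a \<Rightarrow> 'a \<Rightarrow> bool) \<Rightarrow> ('a \<Rightarrow> nat) \<Rightarrow> 'a list \<Rightarrow> 'a list \<Rightarrow> nat" where
  "cross_weight R \<omega> p q = (\<Sum>u\<leftarrow>p. \<Sum>w\<leftarrow>q. if R u w then \<omega> u * \<omega> w else 0)"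

fun forward_weight :: "('a \<Rightarrow> 'a \<Rightarrow> bool) \<Rightarrow> ('a \<Rightarrow> nat) \<Rightarrow> 'a list \<Rightarrow> nat" where
  "forward_weight R \<omega> [] = 0"
| "forward_weight R \<omega> (u # us) = cross_weight R \<omega> [u] us + forward_weight R \<omega> us"

text \<open>This is one half of the feedback property of median orders: the half about intervals
  ending at \<open>v\<close>.\<close>

definition back_dominated :: "('a \<Rightarrow> 'a \<Rightarrow> bool) \<Rightarrow> ('a \<Rightarrow> nat) \<Rightarrow> 'a list \<Rightarrow> bool" where
  "back_dominated R \<omega> L \<longleftrightarrow> (\<forall>p q v s. L = p @ q @ v # s \<longrightarrow>
     (\<Sum>u\<in>{u \<in> set q. R v u}. \<omega> u) \<le> (\<Sum>u\<in>{u \<in> set q. R u v}. \<omega> u))"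

lemma cross_weight_simps [simp]:
  "cross_weight R \<omega> [] q = 0"
  "cross_weight R \<omega> p [] = 0"
  "cross_weight R \<omega> (p @ p') q = cross_weight R \<omega> p q + cross_weight R \<omega> p' q"
  "cross_weight R \<omega> p (q @ q') = cross_weight R \<omega> p q + cross_weight R \<omega> p q'"
  by (auto simp: cross_weight_def sum_list_addf)

lemma cross_weight_Cons:
  "cross_weight R \<omega> (u # p) q = cross_weight R \<omega> [u] q + cross_weight R \<omega> p q"
  by (simp add: cross_weight_def)

lemma forward_weight_append:
  "forward_weight R \<omega> (p @ q) = forward_weight R \<omega> p + cross_weight R \<omega> p q + forward_weight R \<omega> q"
proof (induction p)
  case (Cons u p)
  then show ?case using cross_weight_Cons[of R \<omega> u p q] by simp
qed simp

lemma cross_weight_singleton: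
  assumes "distinct q"
  shows "cross_weight R \<omega> [v] q = \<omega> v * (\<Sum>u\<in>{u \<in> set q. R v u}. \<omega> u)"
    and "cross_weight R \<omega> q [v] = \<omega> v * (\<Sum>u\<in>{u \<in> set q. R u v}. \<omega> u)"
proof -
  have "(\<Sum>u\<in>{u \<in> set q. P u}. \<omega> u) = (\<Sum>u\<leftarrow>q. if P u then \<omega> u else 0)" for P
    using assms by (simp add: sum.inter_filter[symmetric] sum_list_distinct_conv_sum_set)
  then show "cross_weight R \<omega> [v] q = \<omega> v * (\<Sum>u\<in>{u \<in> set q. R v u}. \<omega> u)"
    "cross_weight R \<omega> q [v] = \<omega> v * (\<Sum>u\<in>{u \<in> set q. R u v}. \<omega> u)"
    by (auto simp: cross_weight_def sum_list_const_mult[symmetric] intro!: arg_cong[where f = sum_list])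
qed

text \<open>An order of maximal forward weight works: moving \<open>v\<close> in front of the
  interval \<open>q\<close> changes only the arcs between \<open>v\<close> and \<open>q\<close>, and
  the total must not grow. Positivity of \<open>\<omega> v\<close> allows the common factor to be
  cancelled.\<close>

lemma ex_back_dominated:
  assumes "finite V" and pos: "\<And>v. \<omega> v > 0"
  obtains L where "distinct L" "set L = V" "back_dominated R \<omega> L"
proof -
  let ?P = "{L. distinct L \<and> set L = V}"
  have fin: "finite ?P"
    by (rule finite_subset[OF _ finite_subset_distinct[OF \<open>finite V\<close>]]) auto
  have ne: "?P \<noteq> {}"
    using finite_distinct_list[OF \<open>finite V\<close>] by auto
  obtain L where L: "L \<in> ?P" and "forward_weight R \<omega> L = Max (forward_weight R \<omega> ` ?P)"
    using Max_in[of "forward_weight R \<omega> ` ?P"] fin ne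
    by (metis (no_types, lifting) finite_imageI image_iff image_is_empty)
  then have max: "forward_weight R \<omega> L' \<le> forward_weight R \<omega> L" if "L' \<in> ?P" for L'
    using fin that by simp
  have "back_dominated R \<omega> L"
    unfolding back_dominated_def
  proof (intro allI impI)
    fix p q v s assume eq: "L = p @ q @ v # s"
    then have "p @ v # q @ s \<in> ?P" and dq: "distinct q"
      using L by auto
    from max[OF this(1)]
    have "forward_weight R \<omega> (p @ [v] @ q @ s) \<le> forward_weight R \<omega> (p @ q @ [v] @ s)"
      by (simp add: eq)
    then have "cross_weight R \<omega> [v] q \<le> cross_weight R \<omega> q [v]"
      by (simp only: forward_weight_append cross_weight_simps)
    then show "(\<Sum>u\<in>{u \<in> set q. R v u}. \<omega> u) \<le> (\<Sum>u\<in>{u \<in> set q. R u v}. \<omega> u)"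
      using pos[of v] by (simp add: cross_weight_singleton[OF dq])
  qed
  with L that show thesis by auto
qed

lemma back_dominated_suffix:
  "back_dominated R \<omega> (p @ q) \<Longrightarrow> back_dominated R \<omega> q"
  unfolding back_dominated_def by (metis append.assoc)

text \<open>For \<open>v\<close> other than \<open>f\<close> the interval before \<open>v\<close>
  avoids \<open>f\<close>, so nothing changes. At \<open>f\<close> itself the in-weight can only
  grow and the out-weight only shrink.\<close>

lemma back_dominated_reorient_last:
  assumes bd: "back_dominated R \<omega> (M @ [f])" and dist: "distinct (M @ [f])"
    and same: "\<And>u v. u \<in> set M \<Longrightarrow> v \<in> set M \<Longrightarrow> R' u v = R u v"
    and out: "\<And>u. u \<in> set M \<Longrightarrow> R' f u \<Longrightarrow> R f u"
    and into: "\<And>u. u \<in> set M \<Longrightarrow> R u f \<Longrightarrow> R' u f"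
  shows "back_dominated R' \<omega> (M @ [f])"
  unfolding back_dominated_def
proof (intro allI impI)
  fix p q v s assume eq: "M @ [f] = p @ q @ v # s"
  have le: "(\<Sum>u\<in>{u \<in> set q. R v u}. \<omega> u) \<le> (\<Sum>u\<in>{u \<in> set q. R u v}. \<omega> u)"
    using bd eq unfolding back_dominated_def by blast
  show "(\<Sum>u\<in>{u \<in> set q. R' v u}. \<omega> u) \<le> (\<Sum>u\<in>{u \<in> set q. R' u v}. \<omega> u)"
  proof (cases s rule: rev_cases)
    case Nil
    then have "v = f" "set q \<subseteq> set M" using eq by auto
    then have "(\<Sum>u\<in>{u \<in> set q. R' v u}. \<omega> u) \<le> (\<Sum>u\<in>{u \<in> set q. R v u}. \<omega> u)"
      "(\<Sum>u\<in>{u \<in> set q. R u v}. \<omega> u) \<le> (\<Sum>u\<in>{u \<in> set q. R' u v}. \<omega> u)"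
      using out into by (auto intro!: sum_mono2)
    with le show ?thesis by linarith
  next
    case (snoc s' g)
    then have "M = p @ q @ v # s'" using eq by simp
    then have "{u \<in> set q. R' v u} = {u \<in> set q. R v u}" "{u \<in> set q. R' u v} = {u \<in> set q. R u v}"
      using same by auto
    with le show ?thesis by simp
  qed
qed

text \<open>The argument of Havet and Thomasse, with weights: split at the first in-neighbour \<open>b\<close> of
  \<open>f\<close> that is not a second out-neighbour. Before \<open>b\<close>, out-neighbours of \<open>f\<close> are out-neighbours
  of \<open>b\<close>, so domination at \<open>b\<close> applies; after \<open>b\<close>, induct.\<close>

lemma back_dominated_second_nbrs:
  assumes "back_dominated R \<omega> (M @ [f])" and "distinct (M @ [f])"
    and "\<And>u v. u \<in> set (M @ [f]) \<Longrightarrow> v \<in> set (M @ [f]) \<Longrightarrow> u \<noteq> v \<Longrightarrow> R u v \<longleftrightarrow> \<not> R v u"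
  shows "(\<Sum>u\<in>{u \<in> set M. R f u}. \<omega> u)
    \<le> (\<Sum>u\<in>{u \<in> set M. R u f \<and> (\<exists>w\<in>set M. R f w \<and> R w u)}. \<omega> u)"
  using assms
proof (induction M rule: length_induct)
  case (1 M)
  let ?good = "\<lambda>M u. R u f \<and> (\<exists>w\<in>set M. R f w \<and> R w u)"
  note tour = "1.prems"(3)
  show ?case
  proof (cases "\<exists>b\<in>set M. R b f \<and> \<not> ?good M b")
    case False
    then have "{u \<in> set M. ?good M u} = {u \<in> set M. R u f}" by blast
    moreover have "(\<Sum>u\<in>{u \<in> set M. R f u}. \<omega> u) \<le> (\<Sum>u\<in>{u \<in> set M. R u f}. \<omega> u)"
      using "1.prems"(1) unfolding back_dominated_def by (metis append_Nil)
    ultimately show ?thesis by simp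
  next
    case True
    then obtain p b q where M: "M = p @ b # q" and b: "R b f" "\<not> ?good M b"
      and p: "\<forall>u\<in>set p. \<not> (R u f \<and> \<not> ?good M u)"
      using split_list_first_prop[of M "\<lambda>b. R b f \<and> \<not> ?good M b"] by auto
    have dist: "distinct (p @ b # q @ [f])" using "1.prems"(2) M by simp
    have "back_dominated R \<omega> (q @ [f])"
      using "1.prems"(1) back_dominated_suffix[of R \<omega> "p @ [b]" "q @ [f]"] by (simp add: M)
    then have "(\<Sum>u\<in>{u \<in> set q. R f u}. \<omega> u) \<le> (\<Sum>u\<in>{u \<in> set q. ?good q u}. \<omega> u)"
    proof (intro "1.IH"[rule_format])
      show "u \<in> set (q @ [f]) \<Longrightarrow> v \<in> set (q @ [f]) \<Longrightarrow> u \<noteq> v \<Longrightarrow> R u v \<longleftrightarrow> \<not> R v u" for u v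
        by (rule tour) (auto simp: M)
    qed (use dist in \<open>auto simp: M\<close>)
    also have "\<dots> \<le> (\<Sum>u\<in>{u \<in> set q. ?good M u}. \<omega> u)"
      by (rule sum_mono2) (auto simp: M)
    finally have after: "(\<Sum>u\<in>{u \<in> set q. R f u}. \<omega> u) \<le> (\<Sum>u\<in>{u \<in> set q. ?good M u}. \<omega> u)" .
    \<comment> \<open>Otherwise \<open>u\<close> would lead from \<open>f\<close> to
      \<open>b\<close> and make \<open>b\<close> good.\<close>
    have "R b u" if "u \<in> set p" "R f u" for u
      using that b tour[of b u] dist by (auto simp: M)
    then have "(\<Sum>u\<in>{u \<in> set p. R f u}. \<omega> u) \<le> (\<Sum>u\<in>{u \<in> set p. R b u}. \<omega> u)"
      by (intro sum_mono2) auto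
    also have "\<dots> \<le> (\<Sum>u\<in>{u \<in> set p. R u b}. \<omega> u)"
      using "1.prems"(1) unfolding back_dominated_def M by (metis append.assoc append_Cons append_Nil)
    also have "\<dots> \<le> (\<Sum>u\<in>{u \<in> set p. ?good M u}. \<omega> u)"
    proof (rule sum_mono2)
      show "{u \<in> set p. R u b} \<subseteq> {u \<in> set p. ?good M u}"
      proof clarify
        fix u assume u: "u \<in> set p" "R u b"
        have "\<not> R f u" using u b by (auto simp: M)
        then have "R u f" using u dist tour[of u f] by (auto simp: M)
        with u p show "?good M u" by blast
      qed
    qed auto
    finally have before: "(\<Sum>u\<in>{u \<in> set p. R f u}. \<omega> u) \<le> (\<Sum>u\<in>{u \<in> set p. ?good M u}. \<omega> u)" .
    have "\<not> R f b" using b dist tour[of f b] by (auto simp: M)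
    \<comment> \<open>As an in-neighbour of \<open>f\<close> that is not good, \<open>b\<close>
      counts on neither side of the claim.\<close>
    have split: "(\<Sum>u\<in>{u \<in> set M. Q u}. \<omega> u)
        = (\<Sum>u\<in>{u \<in> set p. Q u}. \<omega> u) + (\<Sum>u\<in>{u \<in> set q. Q u}. \<omega> u)" if "\<not> Q b" for Q
    proof -
      have "{u \<in> set M. Q u} = {u \<in> set p. Q u} \<union> {u \<in> set q. Q u}"
        using that by (auto simp: M)
      moreover have "{u \<in> set p. Q u} \<inter> {u \<in> set q. Q u} = {}" using dist by auto
      ultimately show ?thesis by (simp add: sum.union_disjoint)
    qed
    show ?thesis
      unfolding split[of "R f", OF \<open>\<not> R f b\<close>] split[of "?good M", OF b(2)]
      using before after by (rule add_mono)
  qed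
qed

section \<open>Orienting the missing edges\<close>

locale three_missing_stars = oriented_graph D for D :: "'a pair_pre_digraph" +
  fixes x y z :: 'a and A B C :: "'a set"
  assumes centers: "x \<in> pverts D" "y \<in> pverts D" "z \<in> pverts D"
    and cycle: "(x, y) \<in> parcs D" "(y, z) \<in> parcs D" "(z, x) \<in> parcs D"
    and disj: "insert x A \<inter> insert y B = {}" "insert x A \<inter> insert z C = {}"
      "insert y B \<inter> insert z C = {}" "x \<notin> A" "y \<notin> B" "z \<notin> C"
    and missing: "\<And>u v. non_adjacent D u v \<longleftrightarrow>
      (\<exists>(s, S) \<in> {(x, A), (y, B), (z, C)}. u = s \<and> v \<in> S \<or> v = s \<and> u \<in> S)"
begin

definition arrow :: "'a \<Rightarrow> 'a \<Rightarrow> bool" where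
  "arrow u v \<longleftrightarrow> (u, v) \<in> parcs D"

definition near :: "'a \<Rightarrow> 'a \<Rightarrow> bool" where
  "near u v \<longleftrightarrow> arrow u v \<or> (\<exists>w. arrow u w \<and> arrow w v)"

definition spoke :: "'a \<Rightarrow> 'a \<Rightarrow> bool" where
  "spoke s l \<longleftrightarrow> s = x \<and> l \<in> A \<or> s = y \<and> l \<in> B \<or> s = z \<and> l \<in> C"

text \<open>Only paths ending with the new arc from \<open>s\<close> to \<open>l\<close> are tested.
  Paths starting with it do not matter, since missing edges at the last vertex \<open>f\<close> will
  be redirected to \<open>f\<close>.\<close>

definition convenient :: "'a \<Rightarrow> 'a \<Rightarrow> bool" where
  "convenient s l \<longleftrightarrow> (\<forall>v. arrow v s \<longrightarrow> v \<noteq> l \<longrightarrow> near v l)"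

definition tour :: "'a \<Rightarrow> 'a \<Rightarrow> bool" where
  "tour u v \<longleftrightarrow> arrow u v \<or> spoke u v \<and> convenient u v \<or> spoke v u \<and> \<not> convenient v u"

definition weight :: "'a \<Rightarrow> nat" where
  "weight v = (if v \<in> {x, y, z} then 3 else 4)"

lemma arrow_verts: "arrow u v \<Longrightarrow> u \<in> pverts D" "arrow u v \<Longrightarrow> v \<in> pverts D"
  unfolding arrow_def by (auto dest: in_arcsD1 in_arcsD2)

lemma arrow_irrefl: "\<not> arrow v v"
  unfolding arrow_def using pair_no_loops[of "(v, v)"] by auto

lemma arrow_asym: "arrow u v \<Longrightarrow> \<not> arrow v u"
  unfolding arrow_def by (rule no_digons)

lemma arrow_cycle: "arrow x y" "arrow y z" "arrow z x"
  using cycle by (auto simp: arrow_def)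

lemma spoke_iff: "spoke u v \<or> spoke v u \<longleftrightarrow> u \<in> pverts D \<and> v \<in> pverts D \<and> u \<noteq> v \<and> \<not> arrow u v \<and> \<not> arrow v u"
  using missing[of u v] unfolding non_adjacent_def spoke_def arrow_def by auto

lemma spoke_asym: "spoke u v \<Longrightarrow> \<not> spoke v u"
  using disj unfolding spoke_def by auto

lemma tour_iff:
  assumes "u \<in> pverts D" "v \<in> pverts D" "u \<noteq> v"
  shows "tour u v \<longleftrightarrow> \<not> tour v u"
  using assms spoke_iff[of u v] spoke_asym[of u v] spoke_asym[of v u] arrow_asym[of u v]
  unfolding tour_def by blast

lemma near_centers: "near x y" "near y z" "near z x" "near x z" "near y x" "near z y"
  using arrow_cycle unfolding near_def by blast+

text \<open>Two vertices \<open>f\<close>, \<open>v\<close> spoiling the two orientations of a missing edge \<open>{s, l}\<close> are themselves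
  non-adjacent, and since every center is near every other one, \<open>f\<close> must be a leaf at the
  predecessor of \<open>s\<close> on the cycle.\<close>

lemma fake_second_nbr:
  assumes fl: "arrow f l" and lw: "tour l w" and "w \<noteq> f" "\<not> near f w"
  shows "w = x \<and> f \<in> C \<or> w = y \<and> f \<in> A \<or> w = z \<and> f \<in> B"
proof -
  have "\<not> arrow l w" using fl \<open>\<not> near f w\<close> by (auto simp: near_def)
  moreover have "\<not> (spoke l w \<and> convenient l w)"
    using fl \<open>w \<noteq> f\<close> \<open>\<not> near f w\<close> by (auto simp: convenient_def)
  \<comment> \<open>So the arc from \<open>l\<close> to \<open>w\<close> is a missing edge directed
    to its center because the other direction is inconvenient; \<open>v\<close> witnesses
    this.\<close>
  ultimately have wl: "spoke w l" "\<not> convenient w l"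
    using lw by (auto simp: tour_def)
  then obtain v where v: "arrow v w" "v \<noteq> l" "\<not> near v l"
    by (auto simp: convenient_def)
  have "f \<noteq> v" using fl v(3) by (auto simp: near_def)
  moreover have "\<not> arrow v f" using fl v(3) by (auto simp: near_def)
  moreover have "\<not> arrow f v" using v(1) \<open>\<not> near f w\<close> by (auto simp: near_def)
  ultimately have fv: "spoke f v \<or> spoke v f"
    using spoke_iff[of f v] arrow_verts fl v(1) by blast
  have w: "w \<in> {x, y, z}" using wl(1) by (auto simp: spoke_def)
  have "\<not> spoke f v"
  proof
    assume "spoke f v"
    then have "f \<in> {x, y, z}" by (auto simp: spoke_def)
    then show False using w \<open>w \<noteq> f\<close> \<open>\<not> near f w\<close> near_centers by auto
  qed
  then have vf: "spoke v f" using fv by blast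
  \<comment> \<open>Now \<open>v\<close> is a center with an arc to the center \<open>w\<close>,
    hence its predecessor on the triangle.\<close>
  moreover have "\<not> arrow x z" "\<not> arrow y x" "\<not> arrow z y" using arrow_cycle arrow_asym by blast+
  ultimately show ?thesis
    using v(1) w arrow_irrefl unfolding spoke_def by auto
qed

section \<open>Comparing weights and cardinalities of neighbourhoods\<close>

lemma out_nbrs_eq: "out_nbrs D v = {w \<in> pverts D. arrow v w}"
  by (simp add: out_nbrs_def arrow_def)

lemma second_out_nbrs_eq: "second_out_nbrs D v = {w \<in> pverts D. w \<noteq> v \<and> \<not> arrow v w \<and> near v w}"
  by (auto simp: second_out_nbrs_def arrow_def near_def)

lemma sum_weight:
  assumes "S \<subseteq> pverts D"
  shows "sum weight S + card (S \<inter> {x, y, z}) = 4 * card S"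
proof -
  have "finite S" using assms finite_verts by (simp add: finite_subset)
  then have "card (S \<inter> {x, y, z}) = (\<Sum>v\<in>S. if v \<in> {x, y, z} then 1 else 0)"
    by (simp only: card_eq_sum sum.inter_restrict)
  then have "sum weight S + card (S \<inter> {x, y, z}) = (\<Sum>v\<in>S. 4)"
    by (simp only: sum.distrib[symmetric]) (rule sum.cong, auto simp: weight_def)
  then show ?thesis by simp
qed

text \<open>Here \<open>f\<close> is the last vertex of the weighted median order. The first arc of
  each path counted is an arc of \<open>D\<close>; only the second may be a completed missing
  edge.\<close>

lemma ex_weighted_feed:
  obtains f where "f \<in> pverts D"
    and "sum weight (out_nbrs D f) \<le>
      sum weight {w \<in> pverts D. w \<noteq> f \<and> \<not> arrow f w \<and> (\<exists>l. arrow f l \<and> (arrow l w \<or> tour l w))}"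
proof -
  obtain L where L: "distinct L" "set L = pverts D" and bd: "back_dominated tour weight L"
  proof (rule ex_back_dominated)
    show "finite (pverts D)" using finite_verts by simp
    show "weight v > 0" for v by (simp add: weight_def)
  qed
  have "L \<noteq> []" using L(2) centers(1) by auto
  then obtain M f where LM: "L = M @ [f]" by (cases L rule: rev_cases) auto
  \<comment> \<open>All missing edges at \<open>f\<close> now point to \<open>f\<close>, so the
    out-neighbours of \<open>f\<close> under \<open>R\<close> are those in \<open>D\<close>.\<close>
  define R where "R u v \<longleftrightarrow> (if v = f then u \<noteq> f \<and> \<not> arrow f u else if u = f then arrow f v else tour u v)" for u v
  have fM: "f \<notin> set M" and V: "pverts D = insert f (set M)" using L LM by auto
  have ne: "u \<noteq> f" if "u \<in> set M" for u using that fM by blast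
  have "back_dominated R weight (M @ [f])"
  proof (rule back_dominated_reorient_last)
    show "back_dominated tour weight (M @ [f])" "distinct (M @ [f])" using bd L LM by auto
    show "R u v = tour u v" if "u \<in> set M" "v \<in> set M" for u v
      using ne that by (auto simp: R_def)
    show "tour f u" if "u \<in> set M" "R f u" for u
      using ne that by (auto simp: R_def tour_def)
    show "R u f" if "u \<in> set M" "tour u f" for u
      using ne[OF that(1)] that tour_iff[of u f] V by (auto simp: R_def tour_def)
  qed
  moreover have "R u v \<longleftrightarrow> \<not> R v u" if "u \<in> set (M @ [f])" "v \<in> set (M @ [f])" "u \<noteq> v" for u v
    using that tour_iff[of u v] V by (auto simp: R_def)
  ultimately have "sum weight {u \<in> set M. R f u} \<le>
      sum weight {u \<in> set M. R u f \<and> (\<exists>w\<in>set M. R f w \<and> R w u)}"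
    using L LM by (intro back_dominated_second_nbrs) auto
  moreover have "{u \<in> set M. R f u} = out_nbrs D f"
    using fM arrow_irrefl by (auto simp: R_def out_nbrs_eq V)
  moreover have "{u \<in> set M. R u f \<and> (\<exists>w\<in>set M. R f w \<and> R w u)}
      \<subseteq> {w \<in> pverts D. w \<noteq> f \<and> \<not> arrow f w \<and> (\<exists>l. arrow f l \<and> (arrow l w \<or> tour l w))}"
    using fM by (auto simp: R_def V)
  ultimately have "sum weight (out_nbrs D f) \<le>
      sum weight {w \<in> pverts D. w \<noteq> f \<and> \<not> arrow f w \<and> (\<exists>l. arrow f l \<and> (arrow l w \<or> tour l w))}"
    using finite_verts by (smt (verit) finite_subset le_trans mem_Collect_eq subsetI sum_mono2 zero_le)
  then show thesis using that V by blast
qed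

lemma satisfies_SNC: "satisfies_SNC D"
proof -
  obtain f where f: "f \<in> pverts D" and le: "sum weight (out_nbrs D f) \<le>
      sum weight {w \<in> pverts D. w \<noteq> f \<and> \<not> arrow f w \<and> (\<exists>l. arrow f l \<and> (arrow l w \<or> tour l w))}"
      (is "_ \<le> sum weight ?T")
    by (rule ex_weighted_feed)
  let ?N1 = "out_nbrs D f" and ?N2 = "second_out_nbrs D f" and ?K = "{x, y, z}"
  \<comment> \<open>These are the false second out-neighbours, reached only through a completed
    missing edge.\<close>
  define F where "F = {w \<in> ?T. \<not> near f w}"
  have fin: "finite (pverts D)" by (rule finite_verts)
  have fake: "w = x \<and> f \<in> C \<or> w = y \<and> f \<in> A \<or> w = z \<and> f \<in> B" if "w \<in> F" for w
    using that fake_second_nbr[of f _ w] unfolding F_def near_def by blast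
  have subs: "?N1 \<subseteq> pverts D" "?N2 \<subseteq> pverts D" "F \<subseteq> pverts D"
    by (auto simp: out_nbrs_eq second_out_nbrs_eq F_def)
  have "?T \<subseteq> ?N2 \<union> F" by (auto simp: second_out_nbrs_eq F_def)
  then have "sum weight ?T \<le> sum weight (?N2 \<union> F)"
    using fin subs by (intro sum_mono2) (auto intro: finite_subset)
  also have "\<dots> = sum weight ?N2 + sum weight F"
    using fin subs by (intro sum.union_disjoint) (auto intro: finite_subset simp: second_out_nbrs_eq F_def)
  finally have "sum weight ?N1 \<le> sum weight ?N2 + sum weight F" using le by simp
  then have main: "4 * card ?N1 + card (?N2 \<inter> ?K) \<le> 4 * card ?N2 + sum weight F + card (?N1 \<inter> ?K)"
    using sum_weight[OF subs(1)] sum_weight[OF subs(2)] by linarith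
  \<comment> \<open>An excess of 3 is harmless: the cardinalities in \<open>main\<close> have factor
    4, so integrality removes it.\<close>
  have "sum weight F + card (?N1 \<inter> ?K) \<le> card (?N2 \<inter> ?K) + 3"
  proof (cases "F = {}")
    case True
    have "card (?N1 \<inter> ?K) \<le> card ?K" by (intro card_mono) auto
    also have "\<dots> \<le> 3" by (simp add: card_insert_if)
    finally show ?thesis using True by simp
  next
    case False
    then obtain w where w: "w \<in> F" by blast
    \<comment> \<open>The leaf set containing \<open>f\<close> determines the false neighbour, and
      the leaf sets are disjoint.\<close>
    have "w' = w" if "w' \<in> F" for w'
      using fake[OF w] fake[OF that] disj by auto
    then have "F = {w}" using w by blast
    have "w \<in> ?K" using fake[OF w] by auto
    with \<open>F = {w}\<close> have "sum weight F = 3" by (auto simp: weight_def)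
    moreover have "card (?N1 \<inter> ?K) \<le> card (?N2 \<inter> ?K)"
    proof -
      have nw: "\<not> near f w" using w by (simp add: F_def)
      \<comment> \<open>\<open>?s\<close> is the successor on the triangle. Neither \<open>w\<close>
        nor its predecessor is in \<open>?N1\<close>, as \<open>f\<close> is not near
        \<open>w\<close>. If the remaining center is in \<open>?N1\<close>, its successor, the
        predecessor of \<open>w\<close>, is in \<open>?N2\<close>.\<close>
      let ?s = "\<lambda>v. if v = x then y else if v = y then z else x"
      have distinct: "x \<noteq> y" "y \<noteq> z" "z \<noteq> x" using disj by auto
      have "inj_on ?s (?N1 \<inter> ?K)" using distinct by (auto simp: inj_on_def)
      moreover have "?s ` (?N1 \<inter> ?K) \<subseteq> ?N2 \<inter> ?K"
        using nw arrow_cycle distinct \<open>w \<in> ?K\<close> centers arrow_asym arrow_irrefl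
        unfolding out_nbrs_eq second_out_nbrs_eq near_def
        by (smt (verit, ccfv_threshold) IntE IntI image_subsetI insert_iff mem_Collect_eq singletonD)
      moreover have "finite (?N2 \<inter> ?K)" by simp
      ultimately show ?thesis by (rule card_inj_on_le)
    qed
    ultimately show ?thesis by simp
  qed
  with main have "card ?N1 \<le> card ?N2" by linarith
  with f show ?thesis by (auto simp: satisfies_SNC_def)
qed

end

section \<open>From stars and induced triangle to the locale\<close>

lemma (in oriented_graph) three_missing_starsI:
  assumes "missing_3_disjoint_stars G x y z"
    and "(x, y) \<in> parcs G" "(y, z) \<in> parcs G" "(z, x) \<in> parcs G"
  shows "\<exists>A B C. three_missing_stars G x y z A B C"
proof -
  obtain A B C where st: "x \<notin> A" "y \<notin> B" "z \<notin> C"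
    and disj: "insert x A \<inter> insert y B = {}" "insert x A \<inter> insert z C = {}" "insert y B \<inter> insert z C = {}"
    and edges: "missing_edges G = {{a, x} |a. a \<in> A} \<union> {{a, y} |a. a \<in> B} \<union> {{a, z} |a. a \<in> C}"
  proof -
    obtain S T U where STU: "star x S" "star y T" "star z U"
      "fst S \<inter> fst T = {}" "fst S \<inter> fst U = {}" "fst T \<inter> fst U = {}"
      "missing_edges G = snd S \<union> snd T \<union> snd U"
      using assms(1) unfolding missing_3_disjoint_stars_def missing_graph_def by blast
    from STU(1-3) obtain A B C where "x \<notin> A" "S = (insert x A, {{a, x} |a. a \<in> A})"
      "y \<notin> B" "T = (insert y B, {{a, y} |a. a \<in> B})"
      "z \<notin> C" "U = (insert z C, {{a, z} |a. a \<in> C})"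
      unfolding star_def by blast
    with STU that[of A B C] show thesis by simp
  qed
  have "non_adjacent G u v \<longleftrightarrow> {u, v} \<in> missing_edges G" for u v
    unfolding missing_edges_def by (auto simp: doubleton_eq_iff non_adjacent_def)
  then have "non_adjacent G u v \<longleftrightarrow>
      (\<exists>(s, S) \<in> {(x, A), (y, B), (z, C)}. u = s \<and> v \<in> S \<or> v = s \<and> u \<in> S)" for u v
    unfolding edges by (auto simp: doubleton_eq_iff)
  with st disj assms(2-4) have "three_missing_stars G x y z A B C"
    by unfold_locales (auto dest: in_arcsD1 in_arcsD2)
  then show ?thesis by blast
qed

lemma missing_3_disjoint_stars_swap:
  "missing_3_disjoint_stars D x y z \<Longrightarrow> missing_3_disjoint_stars D x z y"
  unfolding missing_3_disjoint_stars_def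
  by (elim exE conjE, rule_tac x = S in exI, rule_tac x = U in exI, rule_tac x = T in exI)
    (simp add: Int_commute Un_ac)

lemma directed_3_cycle_induced:
  assumes "directed_3_cycle (with_proj D \<restriction> {x, y, z})"
  shows "(x, y) \<in> parcs D \<and> (y, z) \<in> parcs D \<and> (z, x) \<in> parcs D \<or>
    (x, z) \<in> parcs D \<and> (z, y) \<in> parcs D \<and> (y, x) \<in> parcs D"
proof -
  obtain a b c where abc: "a \<noteq> b" "b \<noteq> c" "c \<noteq> a" "{x, y, z} = {a, b, c}"
    and arcs: "arcs_ends (with_proj D \<restriction> {x, y, z}) = {(a, b), (b, c), (c, a)}"
    using assms unfolding directed_3_cycle_def induce_subgraph_verts
    by (elim exE conjE) (rule that)
  have "arcs_ends (with_proj D \<restriction> {x, y, z}) \<subseteq> parcs D"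
    by (auto simp: arcs_ends_def arc_to_ends_def)
  then have "(a, b) \<in> parcs D" "(b, c) \<in> parcs D" "(c, a) \<in> parcs D" unfolding arcs by auto
  \<comment> \<open>The centers are distinct because they form a set of three elements.\<close>
  moreover have "card {x, y, z} = 3" unfolding abc(4) using abc(1-3) by simp
  then have "x \<noteq> y" "y \<noteq> z" "z \<noteq> x" by (auto simp: card_insert_if split: if_splits)
  moreover have "x = a \<or> x = b \<or> x = c" "y = a \<or> y = b \<or> y = c" "z = a \<or> z = b \<or> z = c"
    using abc(4) by blast+
  ultimately show ?thesis by (elim disjE) simp_all
qed

theorem theorem6:
  fixes D :: "'a pair_pre_digraph" and x y z :: 'a
  assumes "oriented_graph D"
    and "missing_3_disjoint_stars D x y z"
    and "directed_3_cycle (with_proj D \<restriction> {x, y, z})"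
    and "\<nexists>e. isolated_vertex (with_proj (dependency_digraph D)) e"
  shows "satisfies_SNC D"
proof -
  interpret oriented_graph D by fact
  \<comment> \<open>The new names shadow the given ones: the last two centers are swapped if the
    triangle runs the other way.\<close>
  obtain x y z where "missing_3_disjoint_stars D x y z"
    "(x, y) \<in> parcs D" "(y, z) \<in> parcs D" "(z, x) \<in> parcs D"
    using directed_3_cycle_induced[OF assms(3)] assms(2) missing_3_disjoint_stars_swap[OF assms(2)]
    by blast
  then obtain A B C where "three_missing_stars D x y z A B C"
    using three_missing_starsI by blast
  then show ?thesis by (rule three_missing_stars.satisfies_SNC)
qed

end
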